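(* Suppose $G\subset\mathbb{R}^n$ is an open set and $\omega:G\to[0,\infty)$ is a measurable function. The following two conditions are equivalent for $0<s<1$ and $0<p<\infty$. (A) There is a constant $C>0$ such that $$\int_G |u(x)|^p\,\omega(x)\,dx\le C\,|u|_{W^{s,p}(G)}^p\qquad\text{for every } u\in C_c(G).$$ (B) There is a constant $c>0$ such that, for every compact set $K\subset G$, $$\int_K\omega(x)\,dx\le c\,\mathrm{cap}_{s,p}(K,G).$$
   Context: $C_c(G)$ denotes the space of (real-valued) continuous functions with compact support in $G$. For a measurable function $u$ on $G$, put $$|u|_{W^{s,p}(G)}=\left(\int_G\int_G\frac{|u(x)-u(y)|^p}{|x-y|^{n+sp}}\,dy\,dx\right)^{1/p}\in[0,\infty].$$ For a compact set $K\subset G$, the $(s,p)$-capacity is $\mathrm{cap}_{s,p}(K,G)=\inf_u |u|_{W^{s,p}(G)}^p$, where the infimum ranges over all real-valued $u\in C_c(G)$ such that $u(x)\ge 1$ for every $x\in K$. *)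

theory Defs
  imports "HOL-Analysis.Analysis"
begin

text \<open>Real powers on \<open>[0,\<infinity>]\<close>, intended for exponents \<open>a > 0\<close> only.\<close>

definition ennreal_powr :: "ennreal \<Rightarrow> real \<Rightarrow> ennreal" where
  "ennreal_powr x a = (if x = \<infinity> then \<infinity> else ennreal (enn2real x powr a))"

lemma ennreal_powr_inverse:
  assumes "p > 0"
  shows "ennreal_powr (ennreal_powr x (1 / p)) p = x"
  using assms by (cases x) (auto simp: ennreal_powr_def powr_powr)

text \<open>A function on \<open>G\<close> is represented by a total function of which only the values on \<open>G\<close>
  matter. Its support is the closure, relative to \<open>G\<close>, of the set of points of \<open>G\<close> where it
  does not vanish, so compactness of the support keeps it away from the boundary of \<open>G\<close>.\<close>

definition Cc :: "'a::topological_space set \<Rightarrow> ('a \<Rightarrow> real) set" where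
  "Cc G = {u. continuous_on G u \<and> compact (G \<inter> closure (support_on G u))}"

text \<open>On the diagonal the quotient is \<open>0 / 0 = 0\<close>.\<close>

definition W_seminorm ::
    "real \<Rightarrow> real \<Rightarrow> (real ^ 'n) set \<Rightarrow> (real ^ 'n \<Rightarrow> real) \<Rightarrow> ennreal" where
  "W_seminorm s p G u =
     ennreal_powr
       (\<integral>\<^sup>+ x\<in>G. (\<integral>\<^sup>+ y\<in>G.
          ennreal (\<bar>u x - u y\<bar> powr p / norm (x - y) powr (real CARD('n) + s * p))
        \<partial>lebesgue) \<partial>lebesgue)
       (1 / p)"

definition capacity ::
    "real \<Rightarrow> real \<Rightarrow> (real ^ 'n) set \<Rightarrow> (real ^ 'n) set \<Rightarrow> ennreal" where
  "capacity s p K G =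
     (INF u\<in>{u \<in> Cc G. \<forall>x\<in>K. u x \<ge> 1}. ennreal_powr (W_seminorm s p G u) p)"

end

theory Submission
  imports Defs
begin

text \<open>
  The implication from (B) to (A) is Maz'ya's truncation argument. If \<open>\<bar>u\<bar> \<le> M\<close>, let \<open>u\<^sub>i\<close>
  be \<open>\<bar>u\<bar>\<close> truncated to the dyadic layer \<open>[t\<^sub>i, 2 t\<^sub>i]\<close> with \<open>t\<^sub>i = M / 2\<^sup>i\<^sup>+\<^sup>2\<close>, shifted and scaled to
  take values in \<open>[0, 1]\<close>. It is a competitor for the capacity of \<open>{\<bar>u\<bar> \<ge> 2 t\<^sub>i}\<close>, so (B) bounds
  \<open>\<integral> \<bar>u\<bar>\<^sup>p \<omega>\<close> by the sum of the energies of \<open>u\<^sub>i\<close> weighted with \<open>(4 t\<^sub>i)\<^sup>p\<close>. The nonlocal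
  energies are added up pointwise: of the layers longer than \<open>\<bar>a - b\<bar>\<close> at most two meet the
  interval between \<open>a\<close> and \<open>b\<close>, and the shorter layers form a geometric series; hence
  \<open>\<Sum>\<^sub>i (4 t\<^sub>i \<bar>u\<^sub>i(x) - u\<^sub>i(y)\<bar>)\<^sup>p \<le> B \<bar>u(x) - u(y)\<bar>\<^sup>p\<close> for every \<open>p > 0\<close>.
\<close>

section \<open>Dyadic layers on the real line\<close>

definition clamp_layer :: "real \<Rightarrow> real \<Rightarrow> real" where
  "clamp_layer t a = max t (min a (2 * t))"

text \<open>The clamp is the nearest-point projection onto an interval of length \<open>t\<close>,
  hence 1-Lipschitz. The bound \<open>t\<close> serves the short layers, the bound
  \<open>\<bar>a - b\<bar>\<close> the long ones.\<close>

lemma clamp_layer_diff_le: "t \<ge> 0 \<Longrightarrow> \<bar>clamp_layer t a - clamp_layer t b\<bar> \<le> min t \<bar>a - b\<bar>"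
  by (auto simp: clamp_layer_def max_def min_def)

text \<open>If \<open>j\<close> is the first index with \<open>M / 2 ^ j \<le> d\<close>, all terms
  of the sum come at or after \<open>j\<close>, and the \<open>p\<close>-th powers decrease by the
  ratio \<open>2 powr (- p) < 1\<close>. The geometric series starting below \<open>d powr p\<close>
  gives a bound uniform in \<open>n\<close>; the cutoff by \<open>n\<close> keeps the index set
  finite.\<close>

lemma sum_small_layers_le:
  fixes p M d :: real
  assumes p: "p > 0" and M: "M > 0" and d: "d \<ge> 0"
  shows "(\<Sum>i | i < n \<and> M / 2 ^ i \<le> d. (M / 2 ^ i) powr p) \<le> d powr p / (1 - 2 powr (- p))"
proof (cases "\<exists>i. M / 2 ^ i \<le> d")
  case False
  then have "(\<Sum>i | i < n \<and> M / 2 ^ i \<le> d. (M / 2 ^ i) powr p) = 0" by simp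
  moreover have "2 powr (- p) < (1::real)" using p by (simp add: powr_less_one)
  ultimately show ?thesis by simp
next
  case True
  define j where "j = (LEAST i. M / 2 ^ i \<le> d)"
  define r :: real where "r = 2 powr (- p)"
  have r: "0 < r" "r < 1" using p by (auto simp: r_def powr_less_one)
  have j: "M / 2 ^ j \<le> d" unfolding j_def using True by (rule LeastI_ex)
  have sub: "{i. i < n \<and> M / 2 ^ i \<le> d} \<subseteq> (\<lambda>m. j + m) ` {..<n}"
  proof
    fix i assume i: "i \<in> {i. i < n \<and> M / 2 ^ i \<le> d}"
    then have "j \<le> i" unfolding j_def by (auto intro: Least_le)
    then show "i \<in> (\<lambda>m. j + m) ` {..<n}" using i by (auto intro!: image_eqI[of _ _ "i - j"])
  qed
  have eq: "(M / 2 ^ (j + m)) powr p = (M / 2 ^ j) powr p * r ^ m" for m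
  proof -
    have "M / 2 ^ (j + m) = (M / 2 ^ j) * (2 powr - real m)"
      by (simp add: power_add powr_minus powr_realpow divide_inverse)
    also have "\<dots> powr p = (M / 2 ^ j) powr p * (2 powr - real m) powr p"
      by (rule powr_mult)
    also have "(2 powr - real m) powr p = r ^ m"
      unfolding r_def by (simp add: powr_powr powr_power mult.commute)
    finally show ?thesis .
  qed
  have "(\<Sum>i | i < n \<and> M / 2 ^ i \<le> d. (M / 2 ^ i) powr p)
      \<le> (\<Sum>i \<in> (\<lambda>m. j + m) ` {..<n}. (M / 2 ^ i) powr p)"
    by (rule sum_mono2) (use sub in auto)
  also have "\<dots> = (\<Sum>m<n. (M / 2 ^ j) powr p * r ^ m)"
    by (subst sum.reindex) (auto simp: eq)
  also have "\<dots> = (M / 2 ^ j) powr p * (\<Sum>m<n. r ^ m)" by (simp add: sum_distrib_left)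
  also have "\<dots> \<le> d powr p * (1 / (1 - r))"
  proof (rule mult_mono)
    show "(M / 2 ^ j) powr p \<le> d powr p"
      using j M p by (intro powr_mono2) auto
    have "(\<Sum>m<n. r ^ m) = (1 - r ^ n) / (1 - r)"
      using r by (subst sum_gp_strict) auto
    also have "\<dots> \<le> 1 / (1 - r)" using r by (intro divide_right_mono) auto
    finally show "(\<Sum>m<n. r ^ m) \<le> 1 / (1 - r)" .
  qed (use r in \<open>auto intro: sum_nonneg\<close>)
  finally show ?thesis by (simp add: r_def)
qed

text \<open>A layer \<open>[t, 2 * t]\<close> longer than \<open>\<bar>a - b\<bar>\<close> can tell
  \<open>a\<close> from \<open>b\<close> only if both lie below \<open>3 * t\<close>. A layer at
  least two dyadic steps higher begins at \<open>4 * t\<close> or above and clamps both to its lower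
  end. Hence only the least separating index \<open>m\<close> and \<open>Suc m\<close> can
  occur.\<close>

lemma card_large_layers_le:
  fixes M a b :: real
  assumes M: "M > 0"
  defines "S \<equiv> {i. \<bar>a - b\<bar> < M / 2 ^ i \<and> clamp_layer (M / 2 ^ i) a \<noteq> clamp_layer (M / 2 ^ i) b}"
  shows "finite S" "card S \<le> 2"
proof -
  have "\<exists>m. S \<subseteq> {m, Suc m}"
  proof (cases "S = {}")
    case False
    define m where "m = (LEAST i. i \<in> S)"
    have m: "m \<in> S" unfolding m_def using False by (auto intro: LeastI_ex)
    have "i \<in> {m, Suc m}" if i: "i \<in> S" for i
    proof (rule ccontr)
      assume "i \<notin> {m, Suc m}"
      moreover have "m \<le> i" unfolding m_def using i by (rule Least_le)
      ultimately have "Suc (Suc m) \<le> i" by auto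
      then obtain k where k: "i = Suc (Suc m) + k" using le_Suc_ex by blast
      define t where "t = M / 2 ^ i"
      define q where "q = M / 2 ^ m"
      have q: "q \<ge> 4 * t"
      proof -
        have "q = 4 * t * 2 ^ k" by (simp add: q_def t_def k power_add field_simps)
        moreover have "4 * t * 1 \<le> 4 * t * 2 ^ k"
          using M by (intro mult_left_mono) (auto simp: t_def)
        ultimately show ?thesis by simp
      qed
      have "t > 0" using M by (simp add: t_def)
      have 1: "\<bar>a - b\<bar> < t" "clamp_layer t a \<noteq> clamp_layer t b" using i by (auto simp: S_def t_def)
      have 2: "clamp_layer q a \<noteq> clamp_layer q b" using m by (auto simp: S_def q_def)
      from 1 2 q \<open>t > 0\<close> show False
        unfolding clamp_layer_def max_def min_def by (auto split: if_splits)
    qed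
    then show ?thesis by auto
  qed auto
  then obtain m where m: "S \<subseteq> {m, Suc m}" by auto
  then show "finite S" by (rule finite_subset) auto
  have "card S \<le> card {m, Suc m}" using m by (intro card_mono) auto
  then show "card S \<le> 2" by simp
qed

text \<open>The short layers are charged their length and give the geometric term; the long layers
  that separate the points number at most two, are charged \<open>\<bar>a - b\<bar>\<close> each,
  and give the 2. The constant depends on \<open>p\<close> alone.\<close>

lemma suminf_clamp_layer_le:
  fixes p M a b :: real
  assumes p: "p > 0" and M: "M > 0"
  shows "(\<Sum>i. ennreal (\<bar>clamp_layer (M / 2 ^ i) a - clamp_layer (M / 2 ^ i) b\<bar> powr p))
    \<le> ennreal ((2 + 1 / (1 - 2 powr (- p))) * \<bar>a - b\<bar> powr p)"
proof -
  define d where "d = \<bar>a - b\<bar>"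
  define f where "f i = \<bar>clamp_layer (M / 2 ^ i) a - clamp_layer (M / 2 ^ i) b\<bar> powr p" for i
  define S where "S = {i. d < M / 2 ^ i \<and> clamp_layer (M / 2 ^ i) a \<noteq> clamp_layer (M / 2 ^ i) b}"
  have S: "finite S" "card S \<le> 2"
    using card_large_layers_le[OF M, of a b] by (auto simp: S_def d_def)
  have f_le: "f i \<le> (M / 2 ^ i) powr p" "f i \<le> d powr p" for i
    unfolding f_def using clamp_layer_diff_le[of "M / 2 ^ i" a b] M p
    by (auto intro!: powr_mono2 simp: d_def)
  have "(\<Sum>i<n. ennreal (f i)) \<le> ennreal ((2 + 1 / (1 - 2 powr (- p))) * d powr p)" for n
  proof -
    have "(\<Sum>i<n. f i) \<le> (\<Sum>i \<in> {i. i < n \<and> M / 2 ^ i \<le> d} \<union> S. f i)"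
    proof -
      \<comment> \<open>A long layer that does not separate the points contributes
        \<open>0 powr p = 0\<close>. Passing to all of \<open>S\<close>, including indices beyond
        \<open>n\<close>, can only increase the sum.\<close>
      have "(\<Sum>i<n. f i) = (\<Sum>i \<in> {..<n} \<inter> ({i. i < n \<and> M / 2 ^ i \<le> d} \<union> S). f i)"
        by (rule sum.mono_neutral_right) (auto simp: f_def S_def)
      also have "\<dots> \<le> (\<Sum>i \<in> {i. i < n \<and> M / 2 ^ i \<le> d} \<union> S. f i)"
        by (rule sum_mono2) (auto simp: f_def S)
      finally show ?thesis .
    qed
    also have "\<dots> = (\<Sum>i | i < n \<and> M / 2 ^ i \<le> d. f i) + (\<Sum>i\<in>S. f i)"
      by (rule sum.union_disjoint) (use S in \<open>auto simp: S_def\<close>)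
    also have "\<dots> \<le> (\<Sum>i | i < n \<and> M / 2 ^ i \<le> d. (M / 2 ^ i) powr p) + (\<Sum>i\<in>S. d powr p)"
      by (intro add_mono sum_mono f_le)
    also have "\<dots> \<le> d powr p / (1 - 2 powr (- p)) + 2 * d powr p"
      using S by (intro add_mono sum_small_layers_le p M) (auto simp: d_def intro!: mult_right_mono)
    also have "\<dots> = (2 + 1 / (1 - 2 powr (- p))) * d powr p" by (simp add: algebra_simps)
    finally show ?thesis by (subst sum_ennreal) (auto simp: f_def intro!: ennreal_leI)
  qed
  then show ?thesis unfolding f_def d_def by (intro suminf_le_const) auto
qed

section \<open>Dyadic levels and functions of compact support\<close>

lemma dyadic_layer_exists:
  fixes M v :: real
  assumes "0 < v" "v \<le> M"
  obtains i where "M / 2 ^ Suc i \<le> v" "v \<le> M / 2 ^ i"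
proof -
  have "(\<lambda>n. M * (1 / 2) ^ n) \<longlonglongrightarrow> M * 0"
    by (intro tendsto_intros) auto
  then have "\<forall>\<^sub>F n in sequentially. M * (1 / 2) ^ n < v"
    using assms by (intro order_tendstoD) auto
  then obtain n where "M * (1 / 2) ^ n < v"
    using eventually_happens'[OF sequentially_bot] by blast
  then have n: "M / 2 ^ n < v" by (simp add: power_one_over)
  define j where "j = (LEAST n. M / 2 ^ n < v)"
  have j: "M / 2 ^ j < v" unfolding j_def using n by (rule LeastI)
  \<comment> \<open>The index \<open>j\<close> is not 0 because \<open>v \<le> M\<close>; its
    predecessor gives the upper bound by minimality.\<close>
  with assms obtain i where i: "j = Suc i" by (cases j) auto
  then have "\<not> M / 2 ^ i < v" unfolding j_def by (metis lessI not_less_Least)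
  with that[of i] i j show thesis by auto
qed

lemma Cc_bounded:
  fixes u :: "'a::metric_space \<Rightarrow> real"
  assumes "u \<in> Cc G"
  obtains M where "M > 0" "\<And>x. x \<in> G \<Longrightarrow> \<bar>u x\<bar> \<le> M"
proof -
  define S where "S = G \<inter> closure (support_on G u)"
  have "continuous_on S u" "compact S"
    using assms by (auto simp: Cc_def S_def intro: continuous_on_subset)
  then have "bounded (u ` S)" by (intro compact_imp_bounded compact_continuous_image)
  then obtain M where M: "M > 0" "\<And>x. x \<in> S \<Longrightarrow> \<bar>u x\<bar> \<le> M"
    by (auto simp: bounded_pos)
  have "\<bar>u x\<bar> \<le> M" if "x \<in> G" for x
  proof (cases "u x = 0")
    case False
    then have "x \<in> S" using that closure_subset by (fastforce simp: S_def support_on_def)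
    then show ?thesis by (rule M)
  qed (use M in auto)
  with M(1) that show thesis by blast
qed

text \<open>A positive level keeps the superlevel set inside the compact support, in which it is
  closed by continuity.\<close>

lemma Cc_superlevel_compact:
  fixes u :: "'a::metric_space \<Rightarrow> real"
  assumes "u \<in> Cc G" "t > 0"
  shows "compact {x \<in> G. t \<le> \<bar>u x\<bar>}"
proof -
  define S where "S = G \<inter> closure (support_on G u)"
  have S: "continuous_on S u" "compact S"
    using assms by (auto simp: Cc_def S_def intro: continuous_on_subset)
  have "{x \<in> G. t \<le> \<bar>u x\<bar>} = {x \<in> S. t \<le> \<bar>u x\<bar>}"
    using \<open>t > 0\<close> closure_subset by (fastforce simp: S_def support_on_def)
  moreover have "closed {x \<in> S. t \<le> \<bar>u x\<bar>}"
    using S by (intro continuous_on_closed_Collect_le continuous_intros) (auto intro: compact_imp_closed)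
  then have "compact (S \<inter> {x \<in> S. t \<le> \<bar>u x\<bar>})"
    using S by (intro compact_Int_closed)
  ultimately show ?thesis by (simp add: Int_def conj_commute conj_left_commute cong: conj_cong)
qed

text \<open>The condition \<open>g 0 = 0\<close> prevents the support from growing, so the new
  support is the old compact one cut by a closed set.\<close>

lemma Cc_compose:
  assumes u: "u \<in> Cc G" and g: "continuous_on UNIV g" "g 0 = 0"
  shows "(\<lambda>x. g (u x)) \<in> Cc G"
proof -
  have "closure (support_on G (\<lambda>x. g (u x))) \<subseteq> closure (support_on G u)"
    using g by (intro closure_mono) (auto simp: support_on_def)
  then have "G \<inter> closure (support_on G (\<lambda>x. g (u x)))
      = (G \<inter> closure (support_on G u)) \<inter> closure (support_on G (\<lambda>x. g (u x)))"
    by auto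
  moreover have "compact \<dots>"
    using u by (intro compact_Int_closed[of "G \<inter> _"]) (auto simp: Cc_def)
  moreover have "continuous_on G (\<lambda>x. g (u x))"
    using u g by (intro continuous_on_compose2[OF g(1)]) (auto simp: Cc_def)
  ultimately show ?thesis by (simp add: Cc_def)
qed

section \<open>The energy as a double integral\<close>

lemma suminf_cmult_nn_integral_lebesgue:
  fixes F :: "nat \<Rightarrow> 'a::euclidean_space \<times> 'a \<Rightarrow> ennreal"
  assumes F [measurable]: "\<And>i. F i \<in> borel_measurable (borel \<Otimes>\<^sub>M borel)"
  shows "(\<Sum>i. c i * (\<integral>\<^sup>+x. \<integral>\<^sup>+y. F i (x, y) \<partial>lebesgue \<partial>lebesgue))
    = (\<integral>\<^sup>+x. \<integral>\<^sup>+y. (\<Sum>i. c i * F i (x, y)) \<partial>lebesgue \<partial>lebesgue)"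
proof -
  have leb: "(\<integral>\<^sup>+x. \<integral>\<^sup>+y. H (x, y) \<partial>lebesgue \<partial>lebesgue) = (\<integral>\<^sup>+x. \<integral>\<^sup>+y. H (x, y) \<partial>lborel \<partial>lborel)"
    if [measurable]: "H \<in> borel_measurable (borel \<Otimes>\<^sub>M borel)" for H :: "'a \<times> 'a \<Rightarrow> ennreal"
  proof -
    have "(\<integral>\<^sup>+y. H (x, y) \<partial>lebesgue) = (\<integral>\<^sup>+y. H (x, y) \<partial>lborel)" for x
      by (rule nn_integral_completion) measurable
    moreover have "(\<lambda>x. \<integral>\<^sup>+y. H (x, y) \<partial>lborel) \<in> borel_measurable lborel" by measurable
    ultimately show ?thesis by (simp add: nn_integral_completion)
  qed
  show ?thesis
    by (simp add: leb leb[of "\<lambda>z. \<Sum>i. c i * F i z", simplified] nn_integral_suminf nn_integral_cmult)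
qed

text \<open>The root cancels, and the two restrictions to \<open>G\<close> merge into one indicator,
  so that the integrand becomes a single function on the product space.\<close>

lemma W_seminorm_powr:
  fixes G :: "(real ^ 'n) set"
  assumes "p > 0"
  shows "ennreal_powr (W_seminorm s p G u) p =
    (\<integral>\<^sup>+x. \<integral>\<^sup>+y. ennreal (\<bar>u x - u y\<bar> powr p / norm (x - y) powr (real CARD('n) + s * p))
      * indicator (G \<times> G) (x, y) \<partial>lebesgue \<partial>lebesgue)"
  unfolding W_seminorm_def ennreal_powr_inverse[OF assms]
  by (intro nn_integral_cong) (auto split: split_indicator intro!: nn_integral_cong)

lemma borel_measurable_W_integrand:
  fixes G :: "(real ^ 'n) set"
  assumes "open G" "continuous_on G u"
  shows "(\<lambda>z. ennreal (\<bar>u (fst z) - u (snd z)\<bar> powr p / norm (fst z - snd z) powr e)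
      * indicator (G \<times> G) z) \<in> borel_measurable (borel \<Otimes>\<^sub>M borel)"
proof -
  have [measurable]: "G \<in> sets borel" using assms by simp
  \<comment> \<open>Only the continuity of \<open>u\<close> on \<open>G\<close> is given. Its
    extension by 0 is Borel on the whole space and yields the same integrand, which carries the
    indicator of \<open>G \<times> G\<close>.\<close>
  have [measurable]: "(\<lambda>x. indicator G x *\<^sub>R u x) \<in> borel_measurable borel"
    using assms by (intro borel_measurable_continuous_on_indicator) auto
  have "(\<lambda>z. ennreal (\<bar>indicator G (fst z) *\<^sub>R u (fst z) - indicator G (snd z) *\<^sub>R u (snd z)\<bar> powr p
      / norm (fst z - snd z) powr e) * indicator (G \<times> G) z) \<in> borel_measurable (borel \<Otimes>\<^sub>M borel)"
    by measurable
  also have "?this \<longleftrightarrow> ?thesis"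
    by (intro measurable_cong) (auto split: split_indicator)
  finally show ?thesis .
qed

section \<open>Layers of a function and the sum of their energies\<close>

definition layer :: "real \<Rightarrow> real \<Rightarrow> real" where
  "layer t a = (clamp_layer t \<bar>a\<bar> - t) / t"

lemma layer_ge_1: "t > 0 \<Longrightarrow> \<bar>a\<bar> \<ge> 2 * t \<Longrightarrow> layer t a \<ge> 1"
  by (simp add: layer_def clamp_layer_def max_def min_def field_simps)

lemma Cc_layer:
  assumes "u \<in> Cc G" "t > 0"
  shows "(\<lambda>x. layer t (u x)) \<in> Cc G"
proof (rule Cc_compose[OF assms(1)])
  show "continuous_on UNIV (layer t)"
    unfolding layer_def clamp_layer_def using assms by (intro continuous_intros) auto
  show "layer t 0 = 0" using assms by (simp add: layer_def clamp_layer_def)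
qed

text \<open>The weight \<open>(4 * t) powr p\<close> cancels the normalisation by \<open>t\<close>
  and leaves \<open>4 powr p\<close> times a clamp difference. The clamp estimate is applied to
  \<open>\<bar>a\<bar>\<close> and \<open>\<bar>b\<bar>\<close>, followed by the reverse triangle
  inequality.\<close>

lemma suminf_layer_le:
  fixes p M a b :: real
  assumes p: "p > 0" and M: "M > 0"
  shows "(\<Sum>i. ennreal ((4 * (M / 2 ^ i)) powr p) *
      ennreal (\<bar>layer (M / 2 ^ i) a - layer (M / 2 ^ i) b\<bar> powr p))
    \<le> ennreal (4 powr p * (2 + 1 / (1 - 2 powr (- p)))) * ennreal (\<bar>a - b\<bar> powr p)"
proof -
  let ?B = "2 + 1 / (1 - 2 powr (- p))"
  have "2 powr (- p) < (1::real)" using p by (simp add: powr_less_one)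
  then have B: "?B \<ge> 0" by auto
  have "ennreal ((4 * t) powr p) * ennreal (\<bar>layer t a - layer t b\<bar> powr p)
      = ennreal (4 powr p) * ennreal (\<bar>clamp_layer t \<bar>a\<bar> - clamp_layer t \<bar>b\<bar>\<bar> powr p)"
    if "t > 0" for t
  proof -
    have "\<bar>layer t a - layer t b\<bar> = \<bar>clamp_layer t \<bar>a\<bar> - clamp_layer t \<bar>b\<bar>\<bar> / t"
      using that by (simp add: layer_def diff_divide_distrib[symmetric])
    then show ?thesis using that
      by (simp add: powr_mult powr_divide ennreal_mult[symmetric])
  qed
  then have "(\<Sum>i. ennreal ((4 * (M / 2 ^ i)) powr p) *
      ennreal (\<bar>layer (M / 2 ^ i) a - layer (M / 2 ^ i) b\<bar> powr p))
    = (\<Sum>i. ennreal (4 powr p) *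
      ennreal (\<bar>clamp_layer (M / 2 ^ i) \<bar>a\<bar> - clamp_layer (M / 2 ^ i) \<bar>b\<bar>\<bar> powr p))"
    using M by (intro suminf_cong) (simp del: times_divide_eq_right)
  also have "\<dots> = ennreal (4 powr p) *
      (\<Sum>i. ennreal (\<bar>clamp_layer (M / 2 ^ i) \<bar>a\<bar> - clamp_layer (M / 2 ^ i) \<bar>b\<bar>\<bar> powr p))"
    by simp
  also have "\<dots> \<le> ennreal (4 powr p) * ennreal (?B * \<bar>\<bar>a\<bar> - \<bar>b\<bar>\<bar> powr p)"
    by (intro mult_left_mono suminf_clamp_layer_le p M) auto
  also have "\<dots> \<le> ennreal (4 powr p) * ennreal (?B * \<bar>a - b\<bar> powr p)"
    using p B by (intro mult_left_mono ennreal_leI powr_mono2) auto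
  also have "\<dots> = ennreal (4 powr p * ?B) * ennreal (\<bar>a - b\<bar> powr p)"
    using B by (simp add: ennreal_mult[symmetric] mult.assoc)
  finally show ?thesis .
qed

lemma suminf_W_seminorm_layer_le:
  fixes G :: "(real ^ 'n) set"
  assumes G: "open G" and u: "u \<in> Cc G" and p: "p > 0" and M: "M > 0"
  shows "(\<Sum>i. ennreal ((4 * (M / 2 ^ i)) powr p) *
      ennreal_powr (W_seminorm s p G (\<lambda>x. layer (M / 2 ^ i) (u x))) p)
    \<le> ennreal (4 powr p * (2 + 1 / (1 - 2 powr (- p)))) * ennreal_powr (W_seminorm s p G u) p"
proof -
  \<comment> \<open>The kernel is the same for all layers, so it factors out of the pointwise
    series. On the diagonal \<open>1 / 0 = 0\<close> matches the convention in the seminorm.\<close>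
  define k :: "(real ^ 'n) \<times> (real ^ 'n) \<Rightarrow> ennreal" where
    "k z = ennreal (1 / norm (fst z - snd z) powr (real CARD('n) + s * p)) * indicator (G \<times> G) z" for z
  define F where "F v z = ennreal (\<bar>v (fst z) - v (snd z)\<bar> powr p) * k z"
    for v :: "real ^ 'n \<Rightarrow> real" and z
  have F: "F v z = ennreal (\<bar>v (fst z) - v (snd z)\<bar> powr p /
      norm (fst z - snd z) powr (real CARD('n) + s * p)) * indicator (G \<times> G) z" for v z
    by (simp add: F_def k_def mult.assoc[symmetric] ennreal_mult[symmetric])
  have W: "ennreal_powr (W_seminorm s p G v) p = (\<integral>\<^sup>+x. \<integral>\<^sup>+y. F v (x, y) \<partial>lebesgue \<partial>lebesgue)" for v
    by (simp add: W_seminorm_powr[OF p] F)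
  have meas: "F v \<in> borel_measurable (borel \<Otimes>\<^sub>M borel)" if "v \<in> Cc G" for v
    using borel_measurable_W_integrand[OF G, of v p "real CARD('n) + s * p"] that
    by (simp add: F[abs_def] Cc_def)
  let ?c = "\<lambda>i. ennreal ((4 * (M / 2 ^ i)) powr p)"
  let ?v = "\<lambda>i x. layer (M / 2 ^ i) (u x)"
  let ?C = "ennreal (4 powr p * (2 + 1 / (1 - 2 powr (- p))))"
  have "(\<Sum>i. ?c i * ennreal_powr (W_seminorm s p G (?v i)) p)
    = (\<integral>\<^sup>+x. \<integral>\<^sup>+y. (\<Sum>i. ?c i * F (?v i) (x, y)) \<partial>lebesgue \<partial>lebesgue)"
    unfolding W using M by (intro suminf_cmult_nn_integral_lebesgue meas Cc_layer u) auto
  \<comment> \<open>The constant is written as a one-term series, so that the same interchange lemma pulls it out.\<close>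
  also have "\<dots> \<le> (\<integral>\<^sup>+x. \<integral>\<^sup>+y. (\<Sum>i::nat. (if i = 0 then ?C else 0) * F u (x, y)) \<partial>lebesgue \<partial>lebesgue)"
  proof (intro nn_integral_mono)
    fix x y
    have "(\<Sum>i. ?c i * F (?v i) (x, y))
        = (\<Sum>i. ?c i * ennreal (\<bar>?v i x - ?v i y\<bar> powr p)) * k (x, y)"
      by (simp add: F_def mult.assoc[symmetric])
    also have "\<dots> \<le> ?C * ennreal (\<bar>u x - u y\<bar> powr p) * k (x, y)"
      by (intro mult_right_mono suminf_layer_le p M) auto
    also have "\<dots> = ?C * F u (x, y)" by (simp add: F_def mult.assoc)
    also have "\<dots> = (\<Sum>i::nat. (if i = 0 then ?C else 0) * F u (x, y))"
      by (subst suminf_finite[of "{0}"]) auto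
    finally show "(\<Sum>i. ?c i * F (?v i) (x, y)) \<le> (\<Sum>i::nat. (if i = 0 then ?C else 0) * F u (x, y))" .
  qed
  also have "\<dots> = (\<Sum>i::nat. (if i = 0 then ?C else 0) * ennreal_powr (W_seminorm s p G u) p)"
    unfolding W by (rule suminf_cmult_nn_integral_lebesgue[symmetric]) (rule meas[OF u])
  also have "\<dots> = ?C * ennreal_powr (W_seminorm s p G u) p"
    by (subst suminf_finite[of "{0}"]) auto
  finally show ?thesis .
qed

section \<open>The two implications\<close>

lemma capacity_bound_if_hardy:
  fixes G :: "(real ^ 'n) set"
  assumes nonneg: "\<And>x. x \<in> G \<Longrightarrow> 0 \<le> \<omega> x" and p: "p > 0" and C: "C > 0"
    and A: "\<And>u. u \<in> Cc G \<Longrightarrow> (\<integral>\<^sup>+ x\<in>G. ennreal (\<bar>u x\<bar> powr p * \<omega> x) \<partial>lebesgue)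
              \<le> ennreal C * ennreal_powr (W_seminorm s p G u) p"
    and K: "K \<subseteq> G"
  shows "(\<integral>\<^sup>+ x\<in>K. ennreal (\<omega> x) \<partial>lebesgue) \<le> ennreal C * capacity s p K G"
proof -
  let ?I = "\<integral>\<^sup>+ x\<in>K. ennreal (\<omega> x) \<partial>lebesgue"
  have *: "?I \<le> ennreal C * ennreal_powr (W_seminorm s p G u) p"
    if u: "u \<in> Cc G" "\<forall>x\<in>K. u x \<ge> 1" for u
  proof -
    have "?I \<le> (\<integral>\<^sup>+ x\<in>G. ennreal (\<bar>u x\<bar> powr p * \<omega> x) \<partial>lebesgue)"
    proof (rule nn_integral_mono)
      fix x
      show "ennreal (\<omega> x) * indicator K x \<le> ennreal (\<bar>u x\<bar> powr p * \<omega> x) * indicator G x"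
      proof (cases "x \<in> K")
        case True
        then have "1 \<le> \<bar>u x\<bar> powr p" using u p by (intro ge_one_powr_ge_zero) force+
        then have "1 * \<omega> x \<le> \<bar>u x\<bar> powr p * \<omega> x"
          using True K nonneg by (intro mult_right_mono) auto
        then show ?thesis using True K by (auto intro!: ennreal_leI)
      qed simp
    qed
    with A[OF u(1)] show ?thesis by (rule order_trans[rotated])
  qed
  \<comment> \<open>Moving the finite positive constant to the left makes the quotient a lower bound
    for the energies of all competitors, hence for their infimum; the constant is multiplied back
    afterwards.\<close>
  have "?I / ennreal C \<le> capacity s p K G"
    unfolding capacity_def
  proof (rule INF_greatest)
    fix u assume "u \<in> {u \<in> Cc G. \<forall>x\<in>K. 1 \<le> u x}"
    then show "?I / ennreal C \<le> ennreal_powr (W_seminorm s p G u) p"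
      using * C by (intro divide_le_posI_ennreal) auto
  qed
  then have "?I / ennreal C * ennreal C \<le> capacity s p K G * ennreal C"
    by (rule mult_right_mono) auto
  moreover have "?I / ennreal C * ennreal C = ?I"
    using C by (simp add: ennreal_divide_times ennreal_mult_divide_eq)
  ultimately show ?thesis by (simp add: mult.commute)
qed

lemma hardy_if_capacity_bound:
  fixes G :: "(real ^ 'n) set"
  assumes G: "open G" and \<omega>: "\<omega> \<in> borel_measurable (lebesgue_on G)"
    and nonneg: "\<And>x. x \<in> G \<Longrightarrow> 0 \<le> \<omega> x" and p: "p > 0"
    and B: "\<And>K. compact K \<Longrightarrow> K \<subseteq> G \<Longrightarrow>
            (\<integral>\<^sup>+ x\<in>K. ennreal (\<omega> x) \<partial>lebesgue) \<le> ennreal c * capacity s p K G"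
    and u: "u \<in> Cc G"
  shows "(\<integral>\<^sup>+ x\<in>G. ennreal (\<bar>u x\<bar> powr p * \<omega> x) \<partial>lebesgue)
    \<le> ennreal c * (ennreal (4 powr p * (2 + 1 / (1 - 2 powr (- p)))) * ennreal_powr (W_seminorm s p G u) p)"
proof -
  obtain M' where M': "M' > 0" "\<And>x. x \<in> G \<Longrightarrow> \<bar>u x\<bar> \<le> M'" using Cc_bounded[OF u] by blast
  \<comment> \<open>With the factor 1/4, \<open>2 * t i\<close> and \<open>4 * t i\<close> are
    \<open>M' / 2 ^ Suc i\<close> and \<open>M' / 2 ^ i\<close>, the ends of the dyadic intervals
    that exhaust \<open>(0, M']\<close>.\<close>
  define M where "M = M' / 4"
  have M: "M > 0" using M' by (simp add: M_def)
  define t where "t i = M / 2 ^ i" for i :: nat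
  have t: "t i > 0" for i using M by (simp add: t_def)
  define K where "K i = {x \<in> G. 2 * t i \<le> \<bar>u x\<bar>}" for i
  have K: "compact (K i)" "K i \<subseteq> G" for i
    unfolding K_def using t[of i] by (auto intro: Cc_superlevel_compact[OF u])
  let ?c = "\<lambda>i. ennreal ((4 * t i) powr p)"
  \<comment> \<open>Measurability of \<open>\<omega>\<close> is known only on \<open>G\<close>, so
    it is extended by 0; on \<open>K i \<subseteq> G\<close> nothing changes.\<close>
  have "(\<lambda>x. \<omega> x * indicator G x) \<in> borel_measurable lebesgue"
    using \<omega> G by (subst (asm) borel_measurable_restrict_space_iff) (auto simp: mult.commute)
  then have meas: "(\<lambda>x. ennreal (\<omega> x) * indicator (K i) x) \<in> borel_measurable lebesgue" for i
  proof -
    assume [measurable]: "(\<lambda>x. \<omega> x * indicator G x) \<in> borel_measurable lebesgue"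
    have [measurable]: "K i \<in> sets lebesgue" using K(1)[of i] by (intro lmeasurable_compact fmeasurableD)
    have "(\<lambda>x. ennreal (\<omega> x * indicator G x) * indicator (K i) x) \<in> borel_measurable lebesgue"
      by measurable
    also have "?this \<longleftrightarrow> ?thesis"
      using K(2)[of i] by (intro measurable_cong) (auto split: split_indicator)
    finally show ?thesis .
  qed
  have cap: "(\<integral>\<^sup>+ x\<in>K i. ennreal (\<omega> x) \<partial>lebesgue)
      \<le> ennreal c * ennreal_powr (W_seminorm s p G (\<lambda>x. layer (t i) (u x))) p" for i
  proof -
    have "(\<lambda>x. layer (t i) (u x)) \<in> {u \<in> Cc G. \<forall>x\<in>K i. u x \<ge> 1}"
      using Cc_layer[OF u t] layer_ge_1[OF t] by (auto simp: K_def)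
    then have "capacity s p (K i) G \<le> ennreal_powr (W_seminorm s p G (\<lambda>x. layer (t i) (u x))) p"
      unfolding capacity_def by (rule INF_lower)
    then have "ennreal c * capacity s p (K i) G
        \<le> ennreal c * ennreal_powr (W_seminorm s p G (\<lambda>x. layer (t i) (u x))) p"
      by (rule mult_left_mono) auto
    with B[OF K] show ?thesis by (rule order_trans)
  qed
  have "(\<integral>\<^sup>+ x\<in>G. ennreal (\<bar>u x\<bar> powr p * \<omega> x) \<partial>lebesgue)
      \<le> (\<integral>\<^sup>+ x. (\<Sum>i. ?c i * (ennreal (\<omega> x) * indicator (K i) x)) \<partial>lebesgue)"
  proof (rule nn_integral_mono)
    fix x
    show "ennreal (\<bar>u x\<bar> powr p * \<omega> x) * indicator G x \<le> (\<Sum>i. ?c i * (ennreal (\<omega> x) * indicator (K i) x))"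
    proof (cases "x \<in> G \<and> u x \<noteq> 0")
      case True
      \<comment> \<open>One term of the series is enough: the lower bound on
        \<open>\<bar>u x\<bar>\<close> puts \<open>x\<close> into \<open>K i\<close>, and the upper
        bound is controlled by the weight of that term.\<close>
      then obtain i where i: "M' / 2 ^ Suc i \<le> \<bar>u x\<bar>" "\<bar>u x\<bar> \<le> M' / 2 ^ i"
        using dyadic_layer_exists[of "\<bar>u x\<bar>" M'] M' by auto
      then have xK: "x \<in> K i" using True by (simp add: K_def t_def M_def)
      have "\<bar>u x\<bar> powr p \<le> (4 * t i) powr p"
        using i p by (intro powr_mono2) (auto simp: t_def M_def)
      then have "ennreal (\<bar>u x\<bar> powr p * \<omega> x) * indicator G x \<le> ennreal ((4 * t i) powr p * \<omega> x)"
        using True nonneg by (auto intro!: ennreal_leI mult_right_mono)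
      also have "\<dots> = ?c i * (ennreal (\<omega> x) * indicator (K i) x)"
        using xK True nonneg by (simp add: ennreal_mult)
      also have "\<dots> = (\<Sum>i\<in>{i}. ?c i * (ennreal (\<omega> x) * indicator (K i) x))" by simp
      also have "\<dots> \<le> (\<Sum>i. ?c i * (ennreal (\<omega> x) * indicator (K i) x))"
        by (rule sum_le_suminf) auto
      finally show ?thesis .
    qed (auto split: split_indicator)
  qed
  also have "\<dots> = (\<Sum>i. ?c i * (\<integral>\<^sup>+ x\<in>K i. ennreal (\<omega> x) \<partial>lebesgue))"
    using meas by (simp add: nn_integral_suminf nn_integral_cmult)
  also have "\<dots> \<le> (\<Sum>i. ?c i * (ennreal c * ennreal_powr (W_seminorm s p G (\<lambda>x. layer (t i) (u x))) p))"
    by (intro suminf_le mult_left_mono cap) auto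
  also have "\<dots> = ennreal c * (\<Sum>i. ?c i * ennreal_powr (W_seminorm s p G (\<lambda>x. layer (t i) (u x))) p)"
    by (subst ennreal_suminf_cmult[symmetric]) (simp add: mult.left_commute)
  also have "\<dots> \<le> ennreal c * (ennreal (4 powr p * (2 + 1 / (1 - 2 powr (- p))))
      * ennreal_powr (W_seminorm s p G u) p)"
    unfolding t_def by (intro mult_left_mono suminf_W_seminorm_layer_le G u p M) auto
  finally show ?thesis .
qed

theorem proposition5:
  fixes G :: "(real ^ 'n) set" and \<omega> :: "real ^ 'n \<Rightarrow> real" and s p :: real
  assumes "open G"
    and "\<omega> \<in> borel_measurable (lebesgue_on G)"
    and "\<And>x. x \<in> G \<Longrightarrow> 0 \<le> \<omega> x"
    and "0 < s" and "s < 1" and "0 < p"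
  shows "(\<exists>C::real. C > 0 \<and> (\<forall>u\<in>Cc G.
            (\<integral>\<^sup>+ x\<in>G. ennreal (\<bar>u x\<bar> powr p * \<omega> x) \<partial>lebesgue)
              \<le> ennreal C * ennreal_powr (W_seminorm s p G u) p))
     \<longleftrightarrow> (\<exists>c::real. c > 0 \<and> (\<forall>K. compact K \<and> K \<subseteq> G \<longrightarrow>
            (\<integral>\<^sup>+ x\<in>K. ennreal (\<omega> x) \<partial>lebesgue) \<le> ennreal c * capacity s p K G))"
proof
  assume "\<exists>C::real. C > 0 \<and> (\<forall>u\<in>Cc G.
            (\<integral>\<^sup>+ x\<in>G. ennreal (\<bar>u x\<bar> powr p * \<omega> x) \<partial>lebesgue)
              \<le> ennreal C * ennreal_powr (W_seminorm s p G u) p)"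
  then obtain C :: real where C: "C > 0" and A: "\<And>u. u \<in> Cc G \<Longrightarrow>
      (\<integral>\<^sup>+ x\<in>G. ennreal (\<bar>u x\<bar> powr p * \<omega> x) \<partial>lebesgue)
        \<le> ennreal C * ennreal_powr (W_seminorm s p G u) p" by auto
  have "(\<integral>\<^sup>+ x\<in>K. ennreal (\<omega> x) \<partial>lebesgue) \<le> ennreal C * capacity s p K G"
    if "K \<subseteq> G" for K
    using assms(3,6) C A that by (rule capacity_bound_if_hardy)
  with C show "\<exists>c::real. c > 0 \<and> (\<forall>K. compact K \<and> K \<subseteq> G \<longrightarrow>
            (\<integral>\<^sup>+ x\<in>K. ennreal (\<omega> x) \<partial>lebesgue) \<le> ennreal c * capacity s p K G)"
    by (intro exI[of _ C]) simp
next
  assume "\<exists>c::real. c > 0 \<and> (\<forall>K. compact K \<and> K \<subseteq> G \<longrightarrow>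
            (\<integral>\<^sup>+ x\<in>K. ennreal (\<omega> x) \<partial>lebesgue) \<le> ennreal c * capacity s p K G)"
  then obtain c :: real where c: "c > 0" and B: "\<And>K. compact K \<Longrightarrow> K \<subseteq> G \<Longrightarrow>
      (\<integral>\<^sup>+ x\<in>K. ennreal (\<omega> x) \<partial>lebesgue) \<le> ennreal c * capacity s p K G" by auto
  \<comment> \<open>The converse direction kept the constant; here it grows by the factor
    \<open>D\<close>, the constant of the layer estimate, which depends only on
    \<open>p\<close>.\<close>
  define D where "D = 4 powr p * (2 + 1 / (1 - 2 powr (- p)))"
  have "2 powr (- p) < (1::real)" using assms(6) by (simp add: powr_less_one)
  then have "D > 0" by (auto simp: D_def intro!: mult_pos_pos add_pos_pos)
  moreover have "(\<integral>\<^sup>+ x\<in>G. ennreal (\<bar>u x\<bar> powr p * \<omega> x) \<partial>lebesgue)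
      \<le> ennreal (c * D) * ennreal_powr (W_seminorm s p G u) p" if "u \<in> Cc G" for u
    using hardy_if_capacity_bound[OF assms(1,2,3,6) B that] c \<open>D > 0\<close>
    by (simp add: D_def[symmetric] ennreal_mult mult.assoc)
  ultimately show "\<exists>C::real. C > 0 \<and> (\<forall>u\<in>Cc G.
            (\<integral>\<^sup>+ x\<in>G. ennreal (\<bar>u x\<bar> powr p * \<omega> x) \<partial>lebesgue)
              \<le> ennreal C * ennreal_powr (W_seminorm s p G u) p)"
    using c by (intro exI[of _ "c * D"]) auto
qed

end
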